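(* Let $y\in\mathbb{R}$ with $y\ne0$, $b>0$, and let $(\gamma^{(k)})_{k\ge0}$ be a sequence of positive reals. Put $x^{(k)}=\frac{y\,\gamma^{(k)}}{b+\gamma^{(k)}}$. Then the iteration scheme $$\gamma^{(k+1)}=\mathop{\arg\min}_{\gamma>0}\ \frac{(x^{(k)})^2}{\gamma}+\tilde g_{\mathrm{SQ}}(\gamma,\gamma^{(k)}),\qquad k\ge0,$$ is equivalent to the iteration scheme $$\gamma^{(k+1)}=\gamma^{(k)}\Big(\frac{y^2}{b+\gamma^{(k)}}\Big)^2,\qquad k\ge0;$$ that is, $(\gamma^{(k)})$ satisfies the first recursion for every $k$ (meaning $\gamma^{(k+1)}$ is the unique minimizer) if and only if it satisfies the second for every $k$, so that from the same initial value $\gamma^{(0)}>0$ both generate the same sequence.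
   Context: For $\gamma,\gamma^{(k)}>0$, the surrogate function is $$\tilde g_{\mathrm{SQ}}(\gamma,\gamma^{(k)})=\log(b+\gamma^{(k)})-\frac{2(\gamma^{(k)})^{3/2}}{b+\gamma^{(k)}}\big(\gamma^{-1/2}-(\gamma^{(k)})^{-1/2}\big),$$ i.e. the first-order Taylor expansion at $\theta^{(k)}=(\gamma^{(k)})^{-1/2}$ of $\theta\mapsto\log(b+\theta^{-2})$, evaluated at $\theta=\gamma^{-1/2}$. *)

theory Defs
  imports "HOL-Analysis.Analysis"
begin

definition surrogate_SQ :: "real \<Rightarrow> real \<Rightarrow> real \<Rightarrow> real" where
  "surrogate_SQ b g gk =
     ln (b + gk) - 2 * gk powr (3/2) / (b + gk) * (g powr (-1/2) - gk powr (-1/2))"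

(* The defining formula is the first-order Taylor expansion of ln (b + theta^(-2)) at
   theta = gk^(-1/2), evaluated at theta = g^(-1/2). *)
lemma surrogate_SQ_eq_taylor:
  fixes b g gk :: real
  assumes "b > 0" "g > 0" "gk > 0"
  defines "f \<equiv> \<lambda>\<theta>::real. ln (b + \<theta> powr (-2))"
  defines "\<theta>k \<equiv> gk powr (-1/2)"
  shows "f differentiable (at \<theta>k)"
    and "surrogate_SQ b g gk = f \<theta>k + deriv f \<theta>k * (g powr (-1/2) - \<theta>k)"
proof -
  have pos: "\<theta>k > 0" using assms(3) by (simp add: \<theta>k_def)
  have v: "\<theta>k powr (-2) = gk" using assms(3) by (simp add: \<theta>k_def powr_powr)
  have w: "\<theta>k powr (-3) = gk powr (3/2)" by (simp add: \<theta>k_def powr_powr)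
  have "b + \<theta>k powr (-2) > 0" using assms(1,3) by (simp add: v)
  then have D: "(f has_real_derivative (- 2 * \<theta>k powr (-3) / (b + \<theta>k powr (-2)))) (at \<theta>k)"
    unfolding f_def using pos
    by (auto intro!: derivative_eq_intros simp: field_simps)
  from D show "f differentiable (at \<theta>k)"
    using real_differentiable_def by blast
  have "deriv f \<theta>k = - 2 * gk powr (3/2) / (b + gk)"
    using DERIV_imp_deriv[OF D] by (simp add: v w)
  moreover have "f \<theta>k = ln (b + gk)" by (simp add: f_def v)
  ultimately show "surrogate_SQ b g gk = f \<theta>k + deriv f \<theta>k * (g powr (-1/2) - \<theta>k)"
    by (simp add: surrogate_SQ_def \<theta>k_def)
qed

definition x_iter :: "real \<Rightarrow> real \<Rightarrow> (nat \<Rightarrow> real) \<Rightarrow> nat \<Rightarrow> real" where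
  "x_iter y b \<gamma> k = y * \<gamma> k / (b + \<gamma> k)"

(* Equality with a singleton says that the next iterate is the unique minimizer over the
   positive reals. *)
definition argmin_scheme :: "real \<Rightarrow> real \<Rightarrow> (nat \<Rightarrow> real) \<Rightarrow> bool" where
  "argmin_scheme y b \<gamma> \<longleftrightarrow>
     (\<forall>k. {g. is_arg_min (\<lambda>g. (x_iter y b \<gamma> k)\<^sup>2 / g + surrogate_SQ b g (\<gamma> k)) (\<lambda>g. g > 0) g}
          = {\<gamma> (Suc k)})"

definition explicit_scheme :: "real \<Rightarrow> real \<Rightarrow> (nat \<Rightarrow> real) \<Rightarrow> bool" where
  "explicit_scheme y b \<gamma> \<longleftrightarrow> (\<forall>k. \<gamma> (Suc k) = \<gamma> k * (y\<^sup>2 / (b + \<gamma> k))\<^sup>2)"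

end

theory Submission
  imports Defs
begin

text \<open>In the variable \<open>\<theta> = \<gamma> powr (-1/2)\<close> the objective is a quadratic with positive leading
  coefficient \<open>x\<^sup>2\<close>. Completing the square gives its vertex, which is
  \<open>m powr (-1/2)\<close> with \<open>m\<close> the explicit update, and \<open>\<theta>\<close> determines \<open>\<gamma>\<close>.\<close>

lemma powr_minus_half:
  fixes g :: real
  assumes "g > 0"
  shows "g powr - (1/2) = 1 / sqrt g"
  using assms powr_minus_divide[of g "1/2"] by (simp add: powr_half_sqrt)

lemma powr_three_halves:
  fixes g :: real
  assumes "g > 0"
  shows "g powr (3/2) = sqrt g ^ 3"
proof -
  have "g powr (3/2) = (g powr (1/2)) powr 3"
    by (simp add: powr_powr)
  also have "\<dots> = sqrt g ^ 3"
    using assms by (simp add: powr_half_sqrt)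
  finally show ?thesis .
qed

text \<open>The hypothesis, in division-free form, places the vertex of the quadratic at
  \<open>u\<close>. Substituting it for \<open>c\<close> turns the linear terms into
  \<open>2 * x\<^sup>2 * u * (u - t)\<close>, which completes the square.\<close>

lemma complete_square:
  fixes x c t u d :: real
  assumes "2 * x\<^sup>2 * u = c"
  shows "(x\<^sup>2 * t\<^sup>2 + (d - c * t)) - (x\<^sup>2 * u\<^sup>2 + (d - c * u)) = x\<^sup>2 * (t - u)\<^sup>2"
  unfolding assms[symmetric] by (simp add: power2_eq_square algebra_simps)

text \<open>An exact formula for the excess over the value at \<open>m\<close> yields minimality and
  uniqueness together, with no calculus.\<close>

lemma surrogate_objective_diff:
  fixes y b g gk :: real
  assumes y: "y \<noteq> 0" and b: "b > 0" and gk: "gk > 0" and g: "g > 0"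
  defines "x \<equiv> y * gk / (b + gk)" and "m \<equiv> gk * (y\<^sup>2 / (b + gk))\<^sup>2"
  shows "(x\<^sup>2 / g + surrogate_SQ b g gk) - (x\<^sup>2 / m + surrogate_SQ b m gk)
           = x\<^sup>2 * (1 / sqrt g - 1 / sqrt m)\<^sup>2"
proof -
  define s where "s = sqrt gk"
  have s: "s > 0" "gk = s\<^sup>2"
    using gk by (simp_all add: s_def)
  define B where "B = b + gk"
  have B: "B > 0"
    using b gk by (simp add: B_def)
  have m: "m > 0"
    using y b gk by (simp add: m_def)
  have sm: "sqrt m = s * (y\<^sup>2 / (b + gk))"
    using b gk by (simp add: m_def real_sqrt_mult s_def)
  \<comment> \<open>Minus the slope of the Taylor polynomial in the variable
    \<open>1 / sqrt g\<close>, as \<open>gk powr (3/2)\<close> is \<open>s ^ 3\<close>.\<close>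
  define c where "c = 2 * s ^ 3 / (b + gk)"
  \<comment> \<open>Both sides reduce to \<open>2 * s ^ 3 / B\<close>. Folding \<open>b + gk\<close>
    into \<open>B\<close> before rewriting \<open>gk\<close> as \<open>s\<^sup>2\<close> keeps the
    denominator atomic.\<close>
  have vertex: "2 * x\<^sup>2 * (1 / sqrt m) = c"
    unfolding sm c_def x_def B_def[symmetric] unfolding s(2) using y s(1) B
    by (simp add: field_simps power2_eq_square power3_eq_cube)
  have objective: "x\<^sup>2 / h + surrogate_SQ b h gk
      = x\<^sup>2 * (1 / sqrt h)\<^sup>2 + (ln (b + gk) + c * (1 / s) - c * (1 / sqrt h))" if "h > 0" for h
    using that gk
    by (simp add: surrogate_SQ_def powr_minus_half powr_three_halves c_def s_def
        power_divide right_diff_distrib)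
  show ?thesis
    unfolding objective[OF g] objective[OF m] by (rule complete_square[OF vertex])
qed

lemma is_arg_min_surrogate_objective_iff:
  fixes y b g gk :: real
  assumes y: "y \<noteq> 0" and b: "b > 0" and gk: "gk > 0"
  shows "is_arg_min (\<lambda>g. (y * gk / (b + gk))\<^sup>2 / g + surrogate_SQ b g gk) (\<lambda>g. g > 0) g
           \<longleftrightarrow> g = gk * (y\<^sup>2 / (b + gk))\<^sup>2"
    (is "is_arg_min ?F _ g \<longleftrightarrow> g = ?m")
proof -
  have m: "?m > 0"
    using y b gk by simp
  have x: "(y * gk / (b + gk))\<^sup>2 > 0"
    using y b gk by simp
  note diff = surrogate_objective_diff[OF y b gk]
  \<comment> \<open>The excess is strictly positive because \<open>sqrt\<close> is injective and the
    factor in front of the square is nonzero.\<close>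
  have gt: "?F ?m < ?F h" if "h > 0" "h \<noteq> ?m" for h
  proof -
    have "1 / sqrt h \<noteq> 1 / sqrt ?m"
      using that(2) by (simp only: divide_cancel_left real_sqrt_eq_iff) simp
    then have "(y * gk / (b + gk))\<^sup>2 * (1 / sqrt h - 1 / sqrt ?m)\<^sup>2 > 0"
      using x by (intro mult_pos_pos) auto
    with diff[OF that(1)] show ?thesis by linarith
  qed
  have ge: "?F ?m \<le> ?F h" if "h > 0" for h
    using gt[OF that] by (cases "h = ?m") (auto intro: less_imp_le)
  show ?thesis
  proof
    assume "is_arg_min ?F (\<lambda>g. g > 0) g"
    \<comment> \<open>Comparing a minimizer with the single competitor \<open>?m\<close> is enough,
      since any other positive point loses to it strictly.\<close>
    then have "g > 0" "\<not> ?F ?m < ?F g"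
      using m unfolding is_arg_min_def by blast+
    then show "g = ?m"
      using gt by blast
  next
    assume g: "g = ?m"
    have "\<not> ?F h < ?F ?m" if "h > 0" for h
      using ge[OF that] by (simp only: not_less)
    with m show "is_arg_min ?F (\<lambda>g. g > 0) g"
      unfolding is_arg_min_def g by blast
  qed
qed

text \<open>Each set of minimizers is the singleton of the explicit update, so the recursions agree
  index by index.\<close>

lemma argmin_scheme_iff_explicit_scheme:
  assumes "y \<noteq> 0" "b > 0" "\<And>k. \<gamma> k > 0"
  shows "argmin_scheme y b \<gamma> \<longleftrightarrow> explicit_scheme y b \<gamma>"
  unfolding argmin_scheme_def explicit_scheme_def x_iter_def
  using is_arg_min_surrogate_objective_iff[OF assms(1,2) assms(3)] by auto

text \<open>Recursion gives existence and induction gives uniqueness. Positivity is carried along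
  because the equivalence of the schemes is only available for positive sequences.\<close>

lemma ex1_explicit_scheme:
  fixes y b g0 :: real
  assumes "y \<noteq> 0" "b > 0" "g0 > 0"
  shows "\<exists>!u. (\<forall>k. u k > 0) \<and> u 0 = g0 \<and> explicit_scheme y b u"
proof -
  define w where "w = rec_nat g0 (\<lambda>_ v. v * (y\<^sup>2 / (b + v))\<^sup>2)"
  have w: "w 0 = g0" "explicit_scheme y b w"
    by (simp_all add: w_def explicit_scheme_def)
  have "w k > 0" for k
  proof (induction k)
    case (Suc k)
    with assms(1,2) show ?case
      by (simp add: w_def)
  qed (simp add: w assms)
  moreover have "u = w" if "u 0 = g0" "explicit_scheme y b u" for u
  proof
    show "u k = w k" for k
      using that w by (induction k) (simp_all add: explicit_scheme_def)
  qed
  ultimately show ?thesis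
    using w by blast
qed

theorem proposition4p4:
  fixes y b :: real
  assumes "y \<noteq> 0" and "b > 0"
  shows "(\<forall>\<gamma> :: nat \<Rightarrow> real. (\<forall>k. \<gamma> k > 0) \<longrightarrow>
            (argmin_scheme y b \<gamma> \<longleftrightarrow> explicit_scheme y b \<gamma>))
       \<and> (\<forall>\<gamma>0 > 0. \<exists>\<gamma> :: nat \<Rightarrow> real.
            {u. (\<forall>k. u k > 0) \<and> u 0 = \<gamma>0 \<and> argmin_scheme y b u} = {\<gamma>}
          \<and> {u. (\<forall>k. u k > 0) \<and> u 0 = \<gamma>0 \<and> explicit_scheme y b u} = {\<gamma>})"
proof (intro conjI allI impI)
  fix \<gamma> :: "nat \<Rightarrow> real"
  assume "\<forall>k. \<gamma> k > 0"
  then show "argmin_scheme y b \<gamma> \<longleftrightarrow> explicit_scheme y b \<gamma>"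
    using argmin_scheme_iff_explicit_scheme[OF assms] by blast
next
  fix g0 :: real
  assume "g0 > 0"
  then obtain w where w: "{u. (\<forall>k. u k > 0) \<and> u 0 = g0 \<and> explicit_scheme y b u} = {w}"
    using ex1_explicit_scheme[OF assms \<open>g0 > 0\<close>] by (auto elim!: ex1E)
  \<comment> \<open>Membership in either set includes positivity, so the equivalence applies to each
    member and the singleton transfers to the argmin scheme.\<close>
  moreover have "{u. (\<forall>k. u k > 0) \<and> u 0 = g0 \<and> argmin_scheme y b u}
      = {u. (\<forall>k. u k > 0) \<and> u 0 = g0 \<and> explicit_scheme y b u}"
    using argmin_scheme_iff_explicit_scheme[OF assms] by blast
  ultimately show "\<exists>\<gamma>. {u. (\<forall>k. u k > 0) \<and> u 0 = g0 \<and> argmin_scheme y b u} = {\<gamma>}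
      \<and> {u. (\<forall>k. u k > 0) \<and> u 0 = g0 \<and> explicit_scheme y b u} = {\<gamma>}"
    by (intro exI[of _ w]) simp
qed

end
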